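(* Let $g,k$ be integers with $2\le k<g$. Then $Y(g,k)$ is a 1089 graph if and only if $(k+1)\mid g$. Moreover, if $Y(g,k)$ is a 1089 graph and $g=b(k+1)$ with $b$ a positive integer, then $Y(g,k)$ consists exactly of the starting node $[[0,0]]$ and the four nodes $[0,k-1]$, $[k-1,k-1]$, $[k-1,0]$, $[0,0]$, with exactly the following edges: $[[0,0]]\to[0,k-1]$ labeled $(b,bk)$; $[0,k-1]\to[k-1,k-1]$ labeled $(b-1,bk-1)$; a self-loop at $[k-1,k-1]$ labeled $(bk+b-1,bk+b-1)$; $[k-1,k-1]\to[k-1,0]$ labeled $(bk-1,b-1)$; $[k-1,0]\to[0,0]$ labeled $(bk,b)$; a self-loop at $[0,0]$ labeled $(0,0)$; and $[0,0]\to[0,k-1]$ labeled $(b,bk)$.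
   Context: Throughout, $g,k$ are integers with $2\le k<g$. The labeled directed graph $H(g,k)$ is built as follows. It has a distinguished starting node, written $[[0,0]]$, and other nodes labeled by pairs $[R,r]$ of integers with $0\le R,r\le k-1$ (the node $[0,0]$ is distinct from the starting node). For a node $[P,p]$ (the starting node being treated as $[P,p]=[0,0]$ for this purpose) there is an edge labeled $(A,a)$ from $[P,p]$ to $[R,r]$ whenever $A,a$ are integers with $0\le A,a\le g-1$, $0\le R,r\le k-1$, and $ka+p=A+rg$, $kA+R=a+Pg$; for edges leaving the starting node one additionally requires $A\neq0$ and $a\neq0$; no edge enters the starting node. $H(g,k)$ consists of the starting node and all nodes reachable from it by such edges. An even pivot node is a node of the form $[a,a]$; an odd pivot node is a node $[r,s]$ having an edge to the node $[s,r]$ (this includes nodes $[a,a]$ with a self-loop); the starting node is not a pivot node. The Young graph $Y(g,k)$ is obtained from $H(g,k)$ by deleting every node that is not a pivot node and from which no pivot node can be reached by a directed path, together with all edges at deleted nodes. Two Young graphs $Y,Y'$ are isomorphic (as Young graphs) if there is a bijection $\phi$ from the nodes of $Y$ to those of $Y'$ that is an isomorphism of the underlying unlabeled directed graphs and such that $x$ is an even (resp. odd) pivot node of $Y$ iff $\phi(x)$ is an even (resp. odd) pivot node of $Y'$. A 1089 graph is a Young graph isomorphic to $Y(10,9)$; $Y(10,9)$ has nodes $[[0,0]],[0,8],[8,8],[8,0],[0,0]$ and edges $[[0,0]]\to[0,8]$, $[0,8]\to[8,8]$, $[8,8]\to[8,8]$, $[8,8]\to[8,0]$, $[8,0]\to[0,0]$,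 $[0,0]\to[0,0]$, $[0,0]\to[0,8]$. *)

theory Defs
  imports Graph_Theory.Graph_Theory
begin

text \<open>\<^term>\<open>Start\<close> is the distinguished starting node [[0,0]]; \<^term>\<open>Node R r\<close> is the node [R,r].\<close>

datatype node = Start | Node int int

fun carries :: "node \<Rightarrow> int \<times> int" where
  "carries Start = (0, 0)"
| "carries (Node P p) = (P, p)"

text \<open>An arc is a triple (source, label, target). Arcs are thus determined by their ends and label.\<close>

type_synonym arc = "node \<times> (int \<times> int) \<times> node"

definition carry_nodes :: "int \<Rightarrow> node set" where
  "carry_nodes k = insert Start {Node R r | R r. 0 \<le> R \<and> R \<le> k - 1 \<and> 0 \<le> r \<and> r \<le> k - 1}"

text \<open>The target of every arc has the form \<^term>\<open>Node R r\<close>, so no arc enters \<^term>\<open>Start\<close>.\<close>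

definition carry_arcs :: "int \<Rightarrow> int \<Rightarrow> arc set" where
  "carry_arcs g k = {(x, (A, a), Node R r) | x A a R r P p.
     x \<in> carry_nodes k \<and> carries x = (P, p) \<and>
     0 \<le> A \<and> A \<le> g - 1 \<and> 0 \<le> a \<and> a \<le> g - 1 \<and>
     0 \<le> R \<and> R \<le> k - 1 \<and> 0 \<le> r \<and> r \<le> k - 1 \<and>
     k * a + p = A + r * g \<and> k * A + R = a + P * g \<and>
     (x = Start \<longrightarrow> A \<noteq> 0 \<and> a \<noteq> 0)}"

definition carry_graph :: "int \<Rightarrow> int \<Rightarrow> (node, arc) pre_digraph" where
  "carry_graph g k = \<lparr> verts = carry_nodes k, arcs = carry_arcs g k,
     tail = (\<lambda>(x, l, y). x), head = (\<lambda>(x, l, y). y) \<rparr>"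

definition H :: "int \<Rightarrow> int \<Rightarrow> (node, arc) pre_digraph" where
  "H g k = carry_graph g k \<restriction> {v. Start \<rightarrow>\<^sup>*\<^bsub>carry_graph g k\<^esub> v}"

definition even_pivots_H :: "int \<Rightarrow> int \<Rightarrow> node set" where
  "even_pivots_H g k = {Node a a | a. Node a a \<in> verts (H g k)}"

definition odd_pivots_H :: "int \<Rightarrow> int \<Rightarrow> node set" where
  "odd_pivots_H g k = {Node r s | r s. Node r s \<in> verts (H g k) \<and>
     Node r s \<rightarrow>\<^bsub>H g k\<^esub> Node s r}"

text \<open>
  A Young graph carries its pivot nodes, since isomorphisms must respect them.
\<close>

record young_graph =
  digraph_of :: "(node, arc) pre_digraph"
  even_pivots :: "node set"
  odd_pivots :: "node set"

text \<open>
  Pivot nodes are kept because \<open>reachable\<close> is reflexive. The starting node has no special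
  status in the deletion.
\<close>

definition Y :: "int \<Rightarrow> int \<Rightarrow> young_graph" where
  "Y g k = \<lparr>
     digraph_of = H g k \<restriction> {x \<in> verts (H g k).
       \<exists>y \<in> even_pivots_H g k \<union> odd_pivots_H g k. x \<rightarrow>\<^sup>*\<^bsub>H g k\<^esub> y},
     even_pivots = even_pivots_H g k,
     odd_pivots = odd_pivots_H g k \<rparr>"

text \<open>
  The underlying unlabeled digraph is the relation \<open>arcs_ends\<close>. This loses no multiplicities:
  for k > 1 the two carry equations determine (A,a) from the two ends of an arc.
\<close>

definition young_iso :: "young_graph \<Rightarrow> young_graph \<Rightarrow> bool" where
  "young_iso Y1 Y2 \<longleftrightarrow> (\<exists>\<phi>. bij_betw \<phi> (verts (digraph_of Y1)) (verts (digraph_of Y2)) \<and>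
     (\<forall>x \<in> verts (digraph_of Y1). \<forall>y \<in> verts (digraph_of Y1).
        x \<rightarrow>\<^bsub>digraph_of Y1\<^esub> y \<longleftrightarrow> \<phi> x \<rightarrow>\<^bsub>digraph_of Y2\<^esub> \<phi> y) \<and>
     (\<forall>x \<in> verts (digraph_of Y1).
        (x \<in> even_pivots Y1 \<longleftrightarrow> \<phi> x \<in> even_pivots Y2) \<and>
        (x \<in> odd_pivots Y1 \<longleftrightarrow> \<phi> x \<in> odd_pivots Y2)))"

definition is_young_graph :: "young_graph \<Rightarrow> bool" where
  "is_young_graph G \<longleftrightarrow> (\<exists>g k. 2 \<le> k \<and> k < g \<and> G = Y g k)"

definition is_1089_graph :: "young_graph \<Rightarrow> bool" where
  "is_1089_graph G \<longleftrightarrow> is_young_graph G \<and> young_iso G (Y 10 9)"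

end

theory Submission
  imports Defs "HOL-Number_Theory.Cong"
begin

text \<open>
  If g = b(k+1), every arc from [P,p] goes to some [p,r] with b(P+r) congruent to p modulo k-1.
  Write k-1 = d1 d2 with d1 coprime to b and d2 dividing a power of b. Modulo d1 the carries vanish
  by forward propagation from the starting node; modulo d2 backward propagation from a pivot makes
  p a multiple of P, so they vanish too. Hence all carries in the Young graph are 0 or k-1.

  Conversely, in a 1089 graph the starting node has one successor [R,r], which is not a pivot and has
  an even pivot [c,c] as successor. Arcs can be reversed by swapping coordinates, so [r,R] is
  reachable. An arc [r,R] to [R,r] would make [r,R] a further predecessor of [R,r], so there is none.
  But if the starting arc is labeled (A,a), then (A+a,A+a) solves the equations of that missing arc,
  so A+a is at least g. This leaves only R = 0, r = k-1 and (k+1)A = g.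
\<close>

section \<open>Arcs, reachability and pivots in the graphs H and Y\<close>

lemma carry_nodes_simps [simp]:
  "Start \<in> carry_nodes k"
  "Node R r \<in> carry_nodes k \<longleftrightarrow> 0 \<le> R \<and> R \<le> k - 1 \<and> 0 \<le> r \<and> r \<le> k - 1"
  by (auto simp: carry_nodes_def)

lemma carry_arcs_iff:
  "(x, (A, a), Node R r) \<in> carry_arcs g k \<longleftrightarrow>
    x \<in> carry_nodes k \<and>
    0 \<le> A \<and> A \<le> g - 1 \<and> 0 \<le> a \<and> a \<le> g - 1 \<and>
    0 \<le> R \<and> R \<le> k - 1 \<and> 0 \<le> r \<and> r \<le> k - 1 \<and>
    k * a + snd (carries x) = A + r * g \<and> k * A + R = a + fst (carries x) * g \<and>
    (x = Start \<longrightarrow> A \<noteq> 0 \<and> a \<noteq> 0)"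
  by (cases "carries x") (auto simp: carry_arcs_def)

lemma carry_arcs_nodes:
  "(x, l, y) \<in> carry_arcs g k \<Longrightarrow> x \<in> carry_nodes k \<and> y \<in> carry_nodes k"
  by (auto simp: carry_arcs_def carry_nodes_def)

lemma no_carry_arc_to_Start [simp]: "(x, l, Start) \<notin> carry_arcs g k"
  by (auto simp: carry_arcs_def)

lemma dominates_carry_graph:
  "x \<rightarrow>\<^bsub>carry_graph g k\<^esub> y \<longleftrightarrow> (\<exists>l. (x, l, y) \<in> carry_arcs g k)"
  by (force simp: arcs_ends_def arc_to_ends_def carry_graph_def)

lemma wf_carry_graph: "wf_digraph (carry_graph g k)"
  by unfold_locales (auto simp: carry_graph_def carry_arcs_def carry_nodes_def)

lemma verts_H: "x \<in> verts (H g k) \<longleftrightarrow> Start \<rightarrow>\<^sup>*\<^bsub>carry_graph g k\<^esub> x"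
  by (simp add: H_def)

lemma dominates_H:
  "x \<rightarrow>\<^bsub>H g k\<^esub> y \<longleftrightarrow>
    (\<exists>l. (x, l, y) \<in> carry_arcs g k) \<and> x \<in> verts (H g k) \<and> y \<in> verts (H g k)"
  by (force simp: arcs_ends_def arc_to_ends_def H_def carry_graph_def)

lemma wf_H: "wf_digraph (H g k)"
  by unfold_locales (auto simp: H_def carry_graph_def)

lemma Start_in_H: "Start \<in> verts (H g k)"
  by (auto simp: verts_H reachable_def carry_graph_def carry_nodes_def)

lemma H_step: "x \<in> verts (H g k) \<Longrightarrow> (x, l, y) \<in> carry_arcs g k \<Longrightarrow> y \<in> verts (H g k)"
  unfolding verts_H
  by (meson wf_digraph.reachable_adj_trans[OF wf_carry_graph] dominates_carry_graph)

lemma H_induct [consumes 1, case_names Start step]: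
  assumes "x \<in> verts (H g k)" and "P Start"
    and "\<And>x l y. x \<in> verts (H g k) \<Longrightarrow> (x, l, y) \<in> carry_arcs g k \<Longrightarrow> P x \<Longrightarrow> P y"
  shows "P x"
  by (rule wf_digraph.reachable_induct[OF wf_carry_graph assms(1)[unfolded verts_H]])
    (use assms(2,3) in \<open>auto simp: verts_H dominates_carry_graph\<close>)

lemma verts_H_subset: "verts (H g k) \<subseteq> carry_nodes k"
proof
  show "x \<in> carry_nodes k" if "x \<in> verts (H g k)" for x
    using that by (induction rule: H_induct) (auto dest: carry_arcs_nodes)
qed

lemma H_cases:
  assumes "y \<in> verts (H g k)"
  obtains "y = Start" | x l where "x \<in> verts (H g k)" "(x, l, y) \<in> carry_arcs g k"
proof -
  have "y = Start \<or> (\<exists>x l. x \<in> verts (H g k) \<and> (x, l, y) \<in> carry_arcs g k)"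
    using assms by (induction rule: H_induct) auto
  then show thesis using that by blast
qed

abbreviation pivots :: "int \<Rightarrow> int \<Rightarrow> node set" where
  "pivots g k \<equiv> even_pivots_H g k \<union> odd_pivots_H g k"

lemma verts_Y:
  "x \<in> verts (digraph_of (Y g k)) \<longleftrightarrow>
    x \<in> verts (H g k) \<and> (\<exists>y \<in> pivots g k. x \<rightarrow>\<^sup>*\<^bsub>H g k\<^esub> y)"
  by (simp add: Y_def)

lemma arcs_Y: "arcs (digraph_of (Y g k)) =
    {(x, l, y). (x, l, y) \<in> carry_arcs g k \<and> x \<in> verts (digraph_of (Y g k)) \<and>
      y \<in> verts (digraph_of (Y g k))}"
  by (auto simp: Y_def H_def carry_graph_def)

lemma dominates_Y:
  "x \<rightarrow>\<^bsub>digraph_of (Y g k)\<^esub> y \<longleftrightarrow>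
    (\<exists>l. (x, l, y) \<in> carry_arcs g k) \<and>
    x \<in> verts (digraph_of (Y g k)) \<and> y \<in> verts (digraph_of (Y g k))"
  by (force simp: arcs_ends_def arc_to_ends_def Y_def H_def carry_graph_def)

lemma pivots_in_Y: "x \<in> pivots g k \<Longrightarrow> x \<in> verts (digraph_of (Y g k))"
  unfolding verts_Y
  by (auto simp: even_pivots_H_def odd_pivots_H_def intro!: bexI[of _ x]
      intro: wf_digraph.reachable_refl[OF wf_H])

text \<open>Reaching a pivot is inherited by predecessors, so deletion never removes a predecessor
  of a surviving node. Statements about arcs into a node of Y can therefore be settled inside
  Y.\<close>

lemma Y_backward_step:
  assumes "x \<in> verts (H g k)" "(x, l, y) \<in> carry_arcs g k" "y \<in> verts (digraph_of (Y g k))"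
  shows "x \<in> verts (digraph_of (Y g k))"
  using assms unfolding verts_Y
  by (meson wf_digraph.adj_reachable_trans[OF wf_H] dominates_H)

lemma even_pivots_Y:
  "x \<in> even_pivots (Y g k) \<longleftrightarrow> x \<in> verts (digraph_of (Y g k)) \<and> (\<exists>a. x = Node a a)"
  using pivots_in_Y[of x g k] by (auto simp: Y_def even_pivots_H_def)

lemma odd_pivots_Y:
  "x \<in> odd_pivots (Y g k) \<longleftrightarrow> x \<in> verts (digraph_of (Y g k)) \<and>
    (\<exists>r s l. x = Node r s \<and> (Node r s, l, Node s r) \<in> carry_arcs g k)"
proof -
  have "x \<in> odd_pivots (Y g k) \<longleftrightarrow>
    x \<in> odd_pivots_H g k" by (simp add: Y_def)
  moreover have "x \<in> verts (H g k)" if "x \<in> verts (digraph_of (Y g k))"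
    using that by (simp add: verts_Y)
  ultimately show ?thesis
    using pivots_in_Y[of x g k] H_step[of x g k]
    by (fastforce simp: odd_pivots_H_def dominates_H)
qed

text \<open>The swap exchanges the two carry equations. The source has to be a \<open>Node\<close>,
  because an arc from \<open>Start\<close> would reverse into one that enters
  \<open>Start\<close>.\<close>

lemma carry_arcs_reverse:
  assumes "(Node P p, (A, a), Node R r) \<in> carry_arcs g k"
  shows "(Node r R, (a, A), Node p P) \<in> carry_arcs g k"
  using assms by (auto simp: carry_arcs_iff)

text \<open>Induction backwards along a path to a pivot; the two kinds of pivot are the base
  cases.\<close>

lemma Y_coreach_induct [consumes 1, case_names even odd step]:
  assumes "x \<in> verts (digraph_of (Y g k))"
    and "\<And>a. Q (Node a a)"
    and "\<And>r s l. (Node r s, l, Node s r) \<in> carry_arcs g k \<Longrightarrow> Q (Node r s)"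
    and "\<And>x l y. (x, l, y) \<in> carry_arcs g k \<Longrightarrow> Q y \<Longrightarrow> Q x"
  shows "Q x"
proof -
  obtain y where y: "y \<in> pivots g k" and xy: "x \<rightarrow>\<^sup>*\<^bsub>H g k\<^esub> y"
    using assms(1) by (auto simp: verts_Y)
  have "Q y"
    using y assms(2,3) by (auto simp: even_pivots_H_def odd_pivots_H_def dominates_H)
  then show ?thesis
    by (rule_tac wf_digraph.converse_reachable_induct[OF wf_H xy])
      (use assms(4) in \<open>auto simp: dominates_H\<close>)
qed

section \<open>Arithmetic for the converse: an arc from \<open>Start\<close> with large digit
  sum\<close>

lemma last_digit_sum_large_imp_dvd:
  fixes g k A a R r :: int
  assumes k: "2 \<le> k" "k < g" and R: "0 \<le> R" and r: "r \<le> k - 1"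
    and e1: "k * A + R = a" and e2: "k * a = A + r * g" and large: "g \<le> A + a"
  shows "(k + 1) dvd g"
proof -
  have A: "(k - 1) * (k + 1) * A = r * g - k * R"
    using e1 e2 by (auto simp: algebra_simps)
  \<comment> \<open>Scaling the bound by \<open>k - 1\<close> lets the two equations eliminate
    \<open>A\<close> and \<open>a\<close>. What remains bounds a sum of two nonnegative terms by 0,
    so both vanish.\<close>
  have "(k - 1) * g \<le> (k - 1) * (A + a)"
    using k large by (intro mult_left_mono) auto
  also have "\<dots> = (k - 1) * (k + 1) * A + (k - 1) * R"
    using e1 by (auto simp: algebra_simps)
  also have "\<dots> = r * g - R"
    unfolding A by (simp add: algebra_simps)
  finally have *: "(k - 1 - r) * g + R \<le> 0"
    by (simp add: algebra_simps)
  have "0 \<le> (k - 1 - r) * g"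
    using k r by (intro mult_nonneg_nonneg) auto
  with * R have "R = 0" and "(k - 1 - r) * g = 0"
    by linarith+
  then have "R = 0" "r = k - 1"
    using k by auto
  with A have "(k - 1) * ((k + 1) * A) = (k - 1) * g"
    by (simp add: algebra_simps)
  then have "(k + 1) * A = g"
    using k by simp
  then show ?thesis by auto
qed

section \<open>The explicit 1089 graph, and a factorization relative to \<open>b\<close>\<close>

definition nodes_1089 :: "int \<Rightarrow> node set" where
  "nodes_1089 k = {Start, Node 0 (k - 1), Node (k - 1) (k - 1), Node (k - 1) 0, Node 0 0}"

definition arcs_1089 :: "int \<Rightarrow> int \<Rightarrow> arc set" where
  "arcs_1089 b k =
    {(Start, (b, b * k), Node 0 (k - 1)),
     (Node 0 (k - 1), (b - 1, b * k - 1), Node (k - 1) (k - 1)),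
     (Node (k - 1) (k - 1), (b * k + b - 1, b * k + b - 1), Node (k - 1) (k - 1)),
     (Node (k - 1) (k - 1), (b * k - 1, b - 1), Node (k - 1) 0),
     (Node (k - 1) 0, (b * k, b), Node 0 0),
     (Node 0 0, (0, 0), Node 0 0),
     (Node 0 0, (b, b * k), Node 0 (k - 1))}"

text \<open>Isomorphisms see only unlabeled edges. Without the labels, \<open>b\<close> disappears,
  so graphs for different \<open>g\<close> become directly comparable.\<close>

definition edges_1089 :: "int \<Rightarrow> (node \<times> node) set" where
  "edges_1089 k =
    {(Start, Node 0 (k - 1)), (Node 0 (k - 1), Node (k - 1) (k - 1)),
     (Node (k - 1) (k - 1), Node (k - 1) (k - 1)), (Node (k - 1) (k - 1), Node (k - 1) 0),
     (Node (k - 1) 0, Node 0 0), (Node 0 0, Node 0 0), (Node 0 0, Node 0 (k - 1))}"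

text \<open>Repeatedly split off the gcd with \<open>b\<close> until the rest is coprime to
  \<open>b\<close>. Each factor split off divides \<open>b\<close>, so the number of rounds serves
  as the exponent \<open>m\<close>.\<close>

lemma coprime_part_decomposition:
  fixes d b :: int
  assumes "d > 0"
  shows "\<exists>d1 d2 m. d = d1 * d2 \<and> coprime d1 b \<and> d2 dvd b ^ m"
  using assms
proof (induction "nat d" arbitrary: d rule: less_induct)
  case less
  show ?case
  proof (cases "coprime d b")
    case True
    then show ?thesis by (intro exI[of _ d] exI[of _ 1]) auto
  next
    case False
    define h where "h = gcd d b"
    have "h > 1"
      using False less.prems unfolding h_def
      by (metis coprime_iff_gcd_eq_1 gcd_pos_int int_one_le_iff_zero_less not_less_iff_gr_or_eq
          order_le_less)
    obtain e where e: "d = h * e"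
      unfolding h_def by (meson dvdE gcd_dvd1)
    have "e > 0"
      using e less.prems \<open>h > 1\<close> by (simp add: zero_less_mult_iff)
    moreover have "e < d"
      using e \<open>h > 1\<close> \<open>e > 0\<close> by simp
    ultimately obtain d1 d2 m where "e = d1 * d2" "coprime d1 b" "d2 dvd b ^ m"
      using less.hyps[of e] by auto
    moreover from this have "h * d2 dvd b ^ Suc m"
      by (simp add: h_def mult_dvd_mono)
    ultimately show ?thesis
      using e by (intro exI[of _ d1] exI[of _ "h * d2"] exI[of _ "Suc m"]) (auto simp: mult_ac)
  qed
qed

section \<open>Carries modulo \<open>k - 1\<close> when \<open>k + 1\<close> divides
  \<open>g\<close>\<close>

locale multiple_of_Suc =
  fixes g k b :: int
  assumes k2: "2 \<le> k" and b_pos: "0 < b" and g_eq: "g = b * (k + 1)"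
begin

text \<open>Subtracting the carry equations shows that \<open>k + 1\<close> divides
  \<open>R - p\<close>, and both carries lie between 0 and \<open>k - 1\<close>, so they agree.
  Substituting this back gives the other two equations; the last one governs the carries modulo
  \<open>k - 1\<close>.\<close>

lemma arc_shift:
  assumes "(x, (A, a), Node R r) \<in> carry_arcs g k" and x: "carries x = (P, p)"
  shows "R = p" and "a = A + (r - P) * b" and "(k - 1) * (A - b * P) = b * (P + r) - p"
proof -
  have e1: "k * a + p = A + r * g" and e2: "k * A + R = a + P * g"
    and bd: "0 \<le> R" "R \<le> k - 1" "0 \<le> p" "p \<le> k - 1"
    using assms by (cases x; auto simp: carry_arcs_iff)+
  have "R - p = (k + 1) * (a + P * b - r * b - A)"
    using e1 e2 unfolding g_eq by (simp add: algebra_simps)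
  then have dv: "(k + 1) dvd (R - p)" by simp
  have "\<bar>R - p\<bar> < k + 1" using bd by auto
  with dv show Rp: "R = p"
    using zdvd_not_zless[of "\<bar>R - p\<bar>" "k + 1"] k2 by (cases "R = p") auto
  have "(k + 1) * (a - A) = (k + 1) * ((r - P) * b)"
    using e1 e2 Rp unfolding g_eq by (simp add: algebra_simps)
  then show a: "a = A + (r - P) * b"
    using k2 by simp
  show "(k - 1) * (A - b * P) = b * (P + r) - p"
    using e1 unfolding a g_eq by (simp add: algebra_simps)
qed

text \<open>Modulo \<open>d1\<close> the new carry satisfies b r = p - b P, and \<open>b\<close> can
  be cancelled. Zero carries thus propagate from \<open>Start\<close> through all of H.\<close>

lemma coprime_part_dvd_H:
  assumes "x \<in> verts (H g k)" "d1 dvd k - 1" "coprime d1 b"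
  shows "d1 dvd fst (carries x) \<and> d1 dvd snd (carries x)"
  using assms(1)
proof (induction rule: H_induct)
  case Start
  then show ?case by simp
next
  case (step x l y)
  obtain A a where l: "l = (A, a)" by (cases l)
  obtain R r where y: "y = Node R r" using step(2) by (cases y) auto
  obtain P p where x: "carries x = (P, p)" by (cases "carries x")
  note arc = arc_shift[OF step(2)[unfolded l y] x]
  have "b * r = (k - 1) * (A - b * P) + p - b * P"
    using arc(3) by (simp add: algebra_simps)
  moreover have "d1 dvd \<dots>"
    using step.IH x assms(2) by (intro dvd_add dvd_diff) auto
  ultimately have "d1 dvd r"
    using assms(3) by (metis coprime_dvd_mult_right_iff)
  then show ?case using step.IH x y arc(1) by simp
qed

text \<open>
  Going back along an arc from [p,r] to [P,p] turns r = t p into (1 - b t) p = b P modulo d2, and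
  1 - b t is a unit there.
\<close>

lemma Y_carries_proportional:
  assumes "x \<in> verts (digraph_of (Y g k))" "d2 dvd k - 1" "d2 dvd b ^ m"
  shows "\<exists>t. d2 dvd snd (carries x) - t * fst (carries x)"
  using assms(1)
proof (induction rule: Y_coreach_induct)
  case (even a)
  then show ?case by (intro exI[of _ 1]) simp
next
  case (odd r s l)
  obtain A a where l: "l = (A, a)" by (cases l)
  \<comment> \<open>The arc at an odd pivot goes from [r,s] to [s,r], so the old P and the new
    second carry are both \<open>r\<close>; hence the factor 2.\<close>
  have "s - 2 * b * r = - ((k - 1) * (A - b * r))"
    using arc_shift(3)[OF odd[unfolded l], of r s] by simp
  then show ?case
    using assms(2) by (intro exI[of _ "2 * b"]) simp
next
  case (step x l y)
  obtain A a where l: "l = (A, a)" by (cases l)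
  obtain R r where y: "y = Node R r" using step(1) by (cases y) auto
  obtain P p where x: "carries x = (P, p)" by (cases "carries x")
  note arc = arc_shift[OF step(1)[unfolded l y] x]
  from step.IH obtain t where t: "d2 dvd r - t * p"
    using y arc(1) by auto
  have "coprime (1 - b * t) (b ^ m)"
  proof -
    have "coprime (1 - b * t) b"
      by (metis coprime_1_left coprime_iff_gcd_eq_1 gcd.commute gcd_add_mult mult.commute
          uminus_add_conv_diff add.commute mult_minus_left)
    then show ?thesis by simp
  qed
  then have "coprime (1 - b * t) d2"
    using assms(3) coprime_divisors dvd_refl by blast
  then obtain u where "[(1 - b * t) * u = 1] (mod d2)"
    using cong_solve_coprime_int by blast
  then have u: "d2 dvd (1 - b * t) * u - 1"
    by (simp add: cong_iff_dvd_diff)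
  \<comment> \<open>\<open>u\<close> inverts \<open>1 - b * t\<close> modulo \<open>d2\<close>; each
    of the three terms on the right is a multiple of \<open>d2\<close>.\<close>
  have "p - u * b * P =
      u * (b * (r - t * p)) - ((1 - b * t) * u - 1) * p - u * ((k - 1) * (A - b * P))"
    unfolding arc(3) by (simp add: algebra_simps)
  moreover have "d2 dvd \<dots>"
    using t u assms(2) by (intro dvd_diff) auto
  ultimately show ?case
    using x by (intro exI[of _ "u * b"]) auto
qed

text \<open>At the target [p,r] of an arc, \<open>r\<close> is a multiple of \<open>p\<close> modulo
  \<open>d2\<close>, so a vanishing \<open>p\<close> makes \<open>r\<close> vanish. The induction
  runs over H; membership in Y is kept as a premise of the claim because it passes from target to
  source.\<close>

lemma nilpotent_part_dvd_Y:
  assumes "x \<in> verts (H g k)" "d2 dvd k - 1" "d2 dvd b ^ m"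
  shows "x \<in> verts (digraph_of (Y g k)) \<Longrightarrow> d2 dvd fst (carries x) \<and> d2 dvd snd (carries x)"
  using assms(1)
proof (induction rule: H_induct)
  case Start
  then show ?case by simp
next
  case (step x l y)
  obtain A a where l: "l = (A, a)" by (cases l)
  obtain R r where y: "y = Node R r" using step(2) by (cases y) auto
  obtain P p where x: "carries x = (P, p)" by (cases "carries x")
  note arc = arc_shift[OF step(2)[unfolded l y] x]
  have "x \<in> verts (digraph_of (Y g k))"
    using Y_backward_step step by blast
  with step.IH have p: "d2 dvd p" using x by simp
  obtain t where "d2 dvd r - t * p"
    using Y_carries_proportional[OF step.prems assms(2,3)] y arc(1) by auto
  then have "d2 dvd r" 
    using p by (metis dvd_diffD dvd_mult dvd_diff_commute diff_add_cancel dvd_add_left_iff)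
  with p show ?case using y arc(1) by simp
qed

lemma Y_carries_dvd:
  assumes "x \<in> verts (digraph_of (Y g k))"
  shows "k - 1 dvd fst (carries x) \<and> k - 1 dvd snd (carries x)"
proof -
  obtain d1 d2 m where d: "k - 1 = d1 * d2" "coprime d1 b" "d2 dvd b ^ m"
    using coprime_part_decomposition[of "k - 1" b] k2 by auto
  then have "coprime d1 d2"
    using coprime_divisors[of d1 d1 d2 "b ^ m"] by simp
  moreover have "x \<in> verts (H g k)" using assms by (simp add: verts_Y)
  ultimately show ?thesis
    unfolding d(1) using coprime_part_dvd_H[of x d1] nilpotent_part_dvd_Y[of x d2 m] assms d
    by (auto intro!: divides_mult)
qed

section \<open>The Young graph determined explicitly when \<open>k + 1\<close> divides
  \<open>g\<close>\<close>

lemma carry_arc_1089: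
  assumes "(x, l, y) \<in> carry_arcs g k" and x: "x \<in> nodes_1089 k" and y: "y \<in> nodes_1089 k"
  shows "(x, l, y) \<in> arcs_1089 b k"
proof -
  obtain A a where l: "l = (A, a)" by (cases l)
  obtain R r where y': "y = Node R r" using assms(1) by (cases y) auto
  obtain P p where x': "carries x = (P, p)" by (cases "carries x")
  note arc = arc_shift[OF assms(1)[unfolded l y'] x']
  obtain \<epsilon> :: int where P: "P = \<epsilon> * (k - 1)" "\<epsilon> \<in> {0, 1}"
    using that[of 0] that[of 1] x x' by (auto simp: nodes_1089_def)
  obtain \<zeta> :: int where p: "p = \<zeta> * (k - 1)" "\<zeta> \<in> {0, 1}"
    using that[of 0] that[of 1] x x' by (auto simp: nodes_1089_def)
  obtain \<eta> :: int where r: "r = \<eta> * (k - 1)" "\<eta> \<in> {0, 1}"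
    using that[of 0] that[of 1] y y' by (auto simp: nodes_1089_def)
  have "(k - 1) * (A - b * P) = (k - 1) * (b * (\<epsilon> + \<eta>) - \<zeta>)"
    using arc(3) unfolding P(1) p(1) r(1) by (simp add: algebra_simps)
  \<comment> \<open>So A = b (\<epsilon> k + \<eta>) - \<zeta>. Of the eight cases,
    (\<epsilon>,\<zeta>,\<eta>) = (0,1,0) gives -1 and (1,0,1) gives \<open>g\<close>, both out of
    range, while (0,0,0) gives 0, which \<open>Start\<close> forbids. The rest are the listed
    arcs.\<close>
  then have A: "A = b * (\<epsilon> + \<eta>) - \<zeta> + b * P"
    using k2 by auto
  have bd: "0 \<le> A" "A \<le> g - 1" "x = Start \<longrightarrow> A \<noteq> 0"
    using assms(1) l y' by (auto simp: carry_arcs_iff)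
  have "x = Node P p \<or> x = Start \<and> P = 0 \<and> p = 0"
    using x' by (cases x) auto
  moreover have "0 < b * k" using k2 b_pos by simp
  ultimately show ?thesis
    using P p r A arc(1,2) bd k2 b_pos
    by (cases "\<epsilon> = 0"; cases "\<zeta> = 0"; cases "\<eta> = 0")
      (auto simp: arcs_1089_def l y' g_eq algebra_simps)
qed

lemma arcs_1089_carry: "arcs_1089 b k \<subseteq> carry_arcs g k"
proof -
  have "0 < b * k" using k2 b_pos by simp
  then have "1 \<le> b * k" by linarith
  then show ?thesis
    using k2 b_pos
    by (auto simp: arcs_1089_def carry_arcs_iff g_eq algebra_simps)
qed

lemma verts_Y_1089: "verts (digraph_of (Y g k)) = nodes_1089 k"
proof
  show "verts (digraph_of (Y g k)) \<subseteq> nodes_1089 k"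
  proof
    fix x assume x: "x \<in> verts (digraph_of (Y g k))"
    show "x \<in> nodes_1089 k"
    proof (cases x)
      case (Node R r)
      have "x \<in> verts (H g k)" using x by (simp add: verts_Y)
      then have bd: "0 \<le> R" "R \<le> k - 1" "0 \<le> r" "r \<le> k - 1"
        using Node verts_H_subset[of g k] by auto
      have "R = 0 \<or> R = k - 1" if "0 \<le> R" "R \<le> k - 1" "k - 1 dvd R" for R
        using that zdvd_not_zless[of R "k - 1"] by fastforce
      then show ?thesis
        using Y_carries_dvd[OF x] bd Node by (fastforce simp: nodes_1089_def)
    qed (simp add: nodes_1089_def)
  qed
next
  let ?d = "k - 1"
  have arcs: "(Start, (b, b * k), Node 0 ?d) \<in> carry_arcs g k"
    "(Node 0 ?d, (b - 1, b * k - 1), Node ?d ?d) \<in> carry_arcs g k"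
    "(Node ?d ?d, (b * k - 1, b - 1), Node ?d 0) \<in> carry_arcs g k"
    "(Node ?d 0, (b * k, b), Node 0 0) \<in> carry_arcs g k"
    using arcs_1089_carry unfolding arcs_1089_def by simp_all
  \<comment> \<open>Walk forward from \<open>Start\<close> to see that all five nodes lie in H, then
    walk back from the even pivots to see that they survive in Y.\<close>
  note h1 = H_step[OF Start_in_H arcs(1)]
  note h2 = H_step[OF h1 arcs(2)]
  note h3 = H_step[OF h2 arcs(3)]
  note h4 = H_step[OF h3 arcs(4)]
  have y4: "Node 0 0 \<in> verts (digraph_of (Y g k))" and y2: "Node ?d ?d \<in> verts (digraph_of (Y g k))"
    using h2 h4 by (auto intro!: pivots_in_Y simp: even_pivots_H_def)
  note y3 = Y_backward_step[OF h3 arcs(4) y4]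
  note y1 = Y_backward_step[OF h1 arcs(2) y2]
  note y0 = Y_backward_step[OF Start_in_H arcs(1) y1]
  show "nodes_1089 k \<subseteq> verts (digraph_of (Y g k))"
    using y0 y1 y2 y3 y4 by (simp add: nodes_1089_def)
qed

lemma arcs_Y_1089: "arcs (digraph_of (Y g k)) = arcs_1089 b k"
proof -
  have "x \<in> nodes_1089 k \<and> y \<in> nodes_1089 k" if "(x, l, y) \<in> arcs_1089 b k" for x l y
    using that by (auto simp: arcs_1089_def nodes_1089_def)
  then show ?thesis
    unfolding arcs_Y verts_Y_1089 using carry_arc_1089 arcs_1089_carry by auto
qed

lemma dominates_Y_1089: "x \<rightarrow>\<^bsub>digraph_of (Y g k)\<^esub> y \<longleftrightarrow> (x, y) \<in> edges_1089 k"
proof -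
  have "x \<rightarrow>\<^bsub>digraph_of (Y g k)\<^esub> y \<longleftrightarrow> (\<exists>l. (x, l, y) \<in> arcs_1089 b k)"
    unfolding dominates_Y using arcs_Y_1089 arcs_Y by blast
  also have "\<dots> \<longleftrightarrow> (x, y) \<in> edges_1089 k"
    by (simp add: arcs_1089_def edges_1089_def ex_disj_distrib)
  finally show ?thesis .
qed

lemma even_pivots_Y_1089: "even_pivots (Y g k) = {Node 0 0, Node (k - 1) (k - 1)}"
  by (auto simp: even_pivots_Y verts_Y_1089 nodes_1089_def)

lemma odd_pivots_Y_1089: "odd_pivots (Y g k) = {Node 0 0, Node (k - 1) (k - 1)}"
proof -
  have "(\<exists>l. (Node r s, l, Node s r) \<in> carry_arcs g k) \<longleftrightarrow> (\<exists>l. (Node r s, l, Node s r) \<in> arcs_1089 b k)"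
    if "Node r s \<in> nodes_1089 k" for r s
  proof -
    have "Node s r \<in> nodes_1089 k" using that by (auto simp: nodes_1089_def)
    then show ?thesis using that carry_arc_1089 arcs_1089_carry by blast
  qed
  then show ?thesis
    using k2 unfolding odd_pivots_Y verts_Y_1089 set_eq_iff
    by (force simp: nodes_1089_def arcs_1089_def)
qed

end

section \<open>Divisibility implies isomorphism with Y(10,9)\<close>

lemma multiple_of_Suc_10_9: "multiple_of_Suc 10 9 1"
  by unfold_locales auto

lemma young_iso_if_dvd:
  assumes "2 \<le> k" "0 < b" "g = b * (k + 1)"
  shows "young_iso (Y g k) (Y 10 9)"
proof -
  interpret G: multiple_of_Suc g k b using assms by unfold_locales
  interpret T: multiple_of_Suc 10 9 1 by (rule multiple_of_Suc_10_9)
  \<comment> \<open>On surviving nodes the coordinates are only 0 and \<open>k - 1\<close>; the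
    latter goes to 8 = 9 - 1.\<close>
  define f :: "int \<Rightarrow> int" where "f c = (if c = 0 then 0 else 8)" for c
  define \<phi> where "\<phi> x = (case x of Start \<Rightarrow> Start | Node R r \<Rightarrow> Node (f R) (f r))" for x
  show ?thesis
    unfolding young_iso_def
  proof (intro exI[of _ \<phi>] conjI ballI)
    show "bij_betw \<phi> (verts (digraph_of (Y g k))) (verts (digraph_of (Y 10 9)))"
      using assms(1) unfolding G.verts_Y_1089 T.verts_Y_1089
      by (auto simp: bij_betw_def inj_on_def nodes_1089_def \<phi>_def f_def)
    fix x assume x: "x \<in> verts (digraph_of (Y g k))"
    then show "x \<in> even_pivots (Y g k) \<longleftrightarrow> \<phi> x \<in> even_pivots (Y 10 9)"
      "x \<in> odd_pivots (Y g k) \<longleftrightarrow> \<phi> x \<in> odd_pivots (Y 10 9)"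
      using assms(1)
      unfolding G.verts_Y_1089 G.even_pivots_Y_1089 T.even_pivots_Y_1089
        G.odd_pivots_Y_1089 T.odd_pivots_Y_1089
      by (auto simp: nodes_1089_def \<phi>_def f_def)
    fix y assume y: "y \<in> verts (digraph_of (Y g k))"
    have "k \<noteq> 1" using assms(1) by simp
    with x y show "x \<rightarrow>\<^bsub>digraph_of (Y g k)\<^esub> y \<longleftrightarrow> \<phi> x \<rightarrow>\<^bsub>digraph_of (Y 10 9)\<^esub> \<phi> y"
      unfolding G.verts_Y_1089 G.dominates_Y_1089 T.dominates_Y_1089 nodes_1089_def
      by (elim insertE emptyE) (simp_all add: edges_1089_def \<phi>_def f_def)
  qed
qed

section \<open>Isomorphism with Y(10,9) implies divisibility\<close>

lemma dvd_if_young_iso: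
  assumes k: "2 \<le> k" "k < g" and iso: "young_iso (Y g k) (Y 10 9)"
  shows "(k + 1) dvd g"
proof -
  interpret T: multiple_of_Suc 10 9 1 by (rule multiple_of_Suc_10_9)
  let ?V = "verts (digraph_of (Y g k))"
  obtain \<phi> where bij: "bij_betw \<phi> ?V (nodes_1089 9)"
    and arc: "\<And>x y. x \<in> ?V \<Longrightarrow> y \<in> ?V \<Longrightarrow>
      x \<rightarrow>\<^bsub>digraph_of (Y g k)\<^esub> y \<longleftrightarrow> (\<phi> x, \<phi> y) \<in> edges_1089 9"
    and even: "\<And>x. x \<in> ?V \<Longrightarrow> (\<exists>a. x = Node a a) \<longleftrightarrow> \<phi> x \<in> {Node 0 0, Node 8 8}"
    using iso
    unfolding young_iso_def T.verts_Y_1089 T.dominates_Y_1089 T.even_pivots_Y_1089 even_pivots_Y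
    by auto
  have surj: "\<exists>x \<in> ?V. \<phi> x = v" if "v \<in> nodes_1089 9" for v
    using that bij_betw_imp_surj_on[OF bij] by (metis imageE)
  obtain s x y where s: "s \<in> ?V" "\<phi> s = Start" and x: "x \<in> ?V" "\<phi> x = Node 0 8"
    and y: "y \<in> ?V" "\<phi> y = Node 8 8"
    using surj[of Start] surj[of "Node 0 8"] surj[of "Node 8 8"] by (auto simp: nodes_1089_def)
  have sx: "s \<rightarrow>\<^bsub>digraph_of (Y g k)\<^esub> x" and xy: "x \<rightarrow>\<^bsub>digraph_of (Y g k)\<^esub> y"
    using s x y by (auto simp: arc edges_1089_def)
  have no_pred: "\<not> u \<rightarrow>\<^bsub>digraph_of (Y g k)\<^esub> s" if "u \<in> ?V" for u
    using that s by (auto simp: arc edges_1089_def)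
  \<comment> \<open>In Y(10,9) the only predecessors of [0,8] are \<open>Start\<close> and the even
    pivot [0,0].\<close>
  have pred: "u = s \<or> (\<exists>a. u = Node a a)" if "u \<in> ?V" "u \<rightarrow>\<^bsub>digraph_of (Y g k)\<^esub> x" for u
  proof -
    have "\<phi> u = Start \<or> \<phi> u = Node 0 0"
      using that x by (auto simp: arc edges_1089_def)
    then show ?thesis
      using even[OF that(1)] that(1) s bij by (auto simp: bij_betw_def inj_on_def)
  qed
  have "s \<in> verts (H g k)" using s by (simp add: verts_Y)
  \<comment> \<open>Any other node of H has a predecessor in H, which would survive in Y and
    contradict \<open>no_pred\<close>.\<close>
  then have s_Start: "s = Start"
  proof (cases rule: H_cases)
    case (2 u l)
    then show ?thesis
      using no_pred[of u] Y_backward_step[of u] s(1) dominates_Y by blast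
  qed
  obtain c where c: "y = Node c c" using even[OF y(1)] y(2) by auto
  obtain A a R r where xR: "x = Node R r" and start: "(Start, (A, a), Node R r) \<in> carry_arcs g k"
    using sx unfolding s_Start dominates_Y by (cases x) auto
  have "R \<noteq> r" using even[OF x(1)] x(2) xR by auto
  have "y \<in> verts (H g k)" using y by (simp add: verts_Y)
  obtain A' a' where "(Node R r, (A', a'), Node c c) \<in> carry_arcs g k"
    using xy xR c by (auto simp: dominates_Y)
  then have "(Node c c, (a', A'), Node r R) \<in> carry_arcs g k"
    by (rule carry_arcs_reverse)
  then have z: "Node r R \<in> verts (H g k)"
    using \<open>y \<in> verts (H g k)\<close> c H_step by blast
  \<comment> \<open>Such an arc would make [r,R] an odd pivot, hence a node of Y preceding
    \<open>x\<close>. By \<open>pred\<close> it would be \<open>Start\<close> or an even pivot, but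
    R and r differ.\<close>
  have no_arc: "(Node r R, (B, b), Node R r) \<notin> carry_arcs g k" for B b
  proof
    assume l: "(Node r R, (B, b), Node R r) \<in> carry_arcs g k"
    have "x \<in> verts (H g k)" using x by (simp add: verts_Y)
    then have "Node r R \<in> odd_pivots_H g k"
      using l z xR by (simp add: odd_pivots_H_def dominates_H) blast
    then have "Node r R \<in> ?V" by (auto intro: pivots_in_Y)
    with pred[of "Node r R"] l x(1) xR s_Start \<open>R \<noteq> r\<close> show False
      by (auto simp: dominates_Y)
  qed
  have e: "k * a = A + r * g" "k * A + R = a"
    and bd: "0 \<le> A" "0 \<le> a" "0 \<le> R" "R \<le> k - 1" "0 \<le> r" "r \<le> k - 1"
    using start by (auto simp: carry_arcs_iff)
  have "g \<le> A + a"
  proof (rule ccontr)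
    assume "\<not> g \<le> A + a"
    \<comment> \<open>For this arc both carry equations coincide with the sum of the two equations
      of the starting arc. The upper digit bound is thus its only possible obstruction.\<close>
    then have "(Node r R, (A + a, A + a), Node R r) \<in> carry_arcs g k"
      using e bd by (auto simp: carry_arcs_iff algebra_simps)
    then show False using no_arc by blast
  qed
  then show ?thesis
    using last_digit_sum_large_imp_dvd[OF k bd(3,6) e(2,1)] by simp
qed

theorem theorem2:
  fixes g k :: int
  assumes "2 \<le> k" and "k < g"
  shows "(is_1089_graph (Y g k) \<longleftrightarrow> (k + 1) dvd g) \<and>
    (\<forall>b::int. is_1089_graph (Y g k) \<and> b > 0 \<and> g = b * (k + 1) \<longrightarrow>
      verts (digraph_of (Y g k)) =
        {Start, Node 0 (k - 1), Node (k - 1) (k - 1), Node (k - 1) 0, Node 0 0} \<and>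
      arcs (digraph_of (Y g k)) =
        {(Start, (b, b * k), Node 0 (k - 1)),
         (Node 0 (k - 1), (b - 1, b * k - 1), Node (k - 1) (k - 1)),
         (Node (k - 1) (k - 1), (b * k + b - 1, b * k + b - 1), Node (k - 1) (k - 1)),
         (Node (k - 1) (k - 1), (b * k - 1, b - 1), Node (k - 1) 0),
         (Node (k - 1) 0, (b * k, b), Node 0 0),
         (Node 0 0, (0, 0), Node 0 0),
         (Node 0 0, (b, b * k), Node 0 (k - 1))})"
proof (intro conjI allI impI)
  have "young_iso (Y g k) (Y 10 9)" if dvd: "(k + 1) dvd g"
  proof -
    obtain b where "g = (k + 1) * b" using dvd by (rule dvdE)
    then have b: "g = b * (k + 1)" by (simp add: mult.commute)
    have "0 < b * (k + 1)" unfolding b[symmetric] using assms by linarith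
    then have "0 < b" using assms(1) by (simp add: zero_less_mult_iff)
    then show ?thesis using young_iso_if_dvd assms(1) b by blast
  qed
  then show "is_1089_graph (Y g k) \<longleftrightarrow> (k + 1) dvd g"
    using dvd_if_young_iso[OF assms] assms by (auto simp: is_1089_graph_def is_young_graph_def)
next
  fix b :: int
  assume b: "is_1089_graph (Y g k) \<and> b > 0 \<and> g = b * (k + 1)"
  interpret multiple_of_Suc g k b using b assms by (simp add: multiple_of_Suc_def)
  show "verts (digraph_of (Y g k)) =
        {Start, Node 0 (k - 1), Node (k - 1) (k - 1), Node (k - 1) 0, Node 0 0}"
    by (rule verts_Y_1089[unfolded nodes_1089_def])
  show "arcs (digraph_of (Y g k)) =
        {(Start, (b, b * k), Node 0 (k - 1)),
         (Node 0 (k - 1), (b - 1, b * k - 1), Node (k - 1) (k - 1)),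
         (Node (k - 1) (k - 1), (b * k + b - 1, b * k + b - 1), Node (k - 1) (k - 1)),
         (Node (k - 1) (k - 1), (b * k - 1, b - 1), Node (k - 1) 0),
         (Node (k - 1) 0, (b * k, b), Node 0 0),
         (Node 0 0, (0, 0), Node 0 0),
         (Node 0 0, (b, b * k), Node 0 (k - 1))}"
    by (rule arcs_Y_1089[unfolded arcs_1089_def])
qed

end
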